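(* Let $(E,\#,\leq,l,\lessdot)$ be a prioritized Prime Event Structure and let $\lessdot'=\lessdot\setminus\{(e,e')\mid e'\# e\vee e'\leq e\vee e\leq e'\}$. Then $\mathrm{Traces}(E,\#,\leq,l,\lessdot)=\mathrm{Traces}(E,\#,\leq,l,\lessdot')$.
   Context: A Prime Event Structure (PES) is a quadruple $\delta=(E,\#,\leq,l)$ where $E$ is a set of events, $\#\subseteq E\times E$ is an irreflexive symmetric relation (conflict), $\leq\subseteq E\times E$ is a partial order (enabling), and $l:E\to Act$ is a labeling function, such that (Conflict Heredity) for all $e,e',e''\in E$, $e\# e'$ and $e'\leq e''$ imply $e\# e''$, and (Finite Causes) for every $e\in E$ the set $\{e'\in E\mid e'\leq e\}$ is finite. For a finite sequence $\sigma=e_1\cdots e_n$ of events write $\bar\sigma=\{e_1,\dots,e_n\}$ and $\sigma_i=e_1\cdots e_i$ ($\sigma_0$ the empty sequence). Define $\mathrm{en}_\delta(\sigma)=\{e\in E\setminus\bar\sigma\mid (\forall e'\in E.\ e'\leq e\wedge e'\neq e\Rightarrow e'\in\bar\sigma)\wedge \neg\exists e'\in\bar\sigma.\ e\# e'\}$. The sequence $\sigma$ is a trace of $\delta$ iff $e_i\in\mathrm{en}_\delta(\sigma_{i-1})$ for all $1\le i\le n$. A prioritized PES (PPES) $(E,\#,\leq,l,\lessdot)$ is a PES together with an acyclic relation $\lessdot\subseteq E\times E$ (priority; $e\lessdot e'$ means $e'$ has higher priority). A sequence $\sigma=e_1\cdots e_n$ is a trace of the PPES iff it is a trace of $(E,\#,\leq,l)$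 and for all $0\le i<n$ and all $e_j,e_h\in\bar\sigma$ with $e_j\neq e_h$, $e_j,e_h\in\mathrm{en}_\delta(\sigma_i)$ and $e_h\lessdot e_j$, we have $j<h$. $\mathrm{Traces}(\cdot)$ denotes the set of traces; the same definition is used when $\lessdot$ is replaced by any subrelation. *)

theory Defs
  imports Main
begin

text \<open>
  Conflict, enabling and priority are sets of pairs of events; the set \<open>Act\<close> of actions
  is the type \<open>'a\<close>, and only the values of \<open>label\<close> on \<open>events\<close> are meaningful.
\<close>

record ('e, 'a) pes =
  events   :: "'e set"
  conflict :: "('e \<times> 'e) set"
  enabling :: "('e \<times> 'e) set"
  label    :: "'e \<Rightarrow> 'a"

locale pes =
  fixes P :: "('e, 'a, 'm) pes_scheme"
  assumes conflict_subset: "conflict P \<subseteq> events P \<times> events P"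
    and conflict_irrefl: "irrefl (conflict P)"
    and conflict_sym: "sym (conflict P)"
    and enabling_subset: "enabling P \<subseteq> events P \<times> events P"
    and enabling_order: "partial_order_on (events P) (enabling P)"
    and conflict_heredity:
      "\<And>e e' e''. \<lbrakk>(e, e') \<in> conflict P; (e', e'') \<in> enabling P\<rbrakk> \<Longrightarrow> (e, e'') \<in> conflict P"
    and finite_causes: "\<And>e. e \<in> events P \<Longrightarrow> finite {e' \<in> events P. (e', e) \<in> enabling P}"

definition en :: "('e, 'a, 'm) pes_scheme \<Rightarrow> 'e list \<Rightarrow> 'e set" where
  "en P \<sigma> =
    {e \<in> events P - set \<sigma>.
       (\<forall>e' \<in> events P. (e', e) \<in> enabling P \<and> e' \<noteq> e \<longrightarrow> e' \<in> set \<sigma>) \<and>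
       \<not> (\<exists>e' \<in> set \<sigma>. (e, e') \<in> conflict P)}"

text \<open>
  Lists are indexed from 0: \<open>\<sigma> ! i\<close> is the event \<open>e\<^sub>i\<^sub>+\<^sub>1\<close> and \<open>take i \<sigma>\<close>
  is the prefix \<open>\<sigma>\<^sub>i\<close> consisting of the first \<open>i\<close> events.
\<close>

definition pes_trace :: "('e, 'a, 'm) pes_scheme \<Rightarrow> 'e list \<Rightarrow> bool" where
  "pes_trace P \<sigma> \<longleftrightarrow> set \<sigma> \<subseteq> events P \<and> (\<forall>i < length \<sigma>. \<sigma> ! i \<in> en P (take i \<sigma>))"

text \<open>\<open>(e, e') \<in> priority P\<close> means that \<open>e'\<close> has the higher priority.\<close>

record ('e, 'a) ppes = "('e, 'a) pes" +
  priority :: "('e \<times> 'e) set"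

locale ppes = pes P
  for P :: "('e, 'a, 'm) ppes_scheme" +
  assumes priority_subset: "priority P \<subseteq> events P \<times> events P"
    and priority_acyclic: "acyclic (priority P)"

definition ppes_trace :: "('e, 'a, 'm) ppes_scheme \<Rightarrow> 'e list \<Rightarrow> bool" where
  "ppes_trace P \<sigma> \<longleftrightarrow>
    pes_trace P \<sigma> \<and>
    (\<forall>i < length \<sigma>. \<forall>j < length \<sigma>. \<forall>h < length \<sigma>.
       \<sigma> ! j \<noteq> \<sigma> ! h \<and> \<sigma> ! j \<in> en P (take i \<sigma>) \<and> \<sigma> ! h \<in> en P (take i \<sigma>) \<and>
       (\<sigma> ! h, \<sigma> ! j) \<in> priority P \<longrightarrow> j < h)"

definition Traces :: "('e, 'a, 'm) ppes_scheme \<Rightarrow> 'e list set" where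
  "Traces P = {\<sigma>. ppes_trace P \<sigma>}"

end

theory Submission
  imports Defs
begin

text \<open>The priority condition compares only distinct events of one trace that are enabled after
  a common prefix. On such pairs the full and the reduced priority relation agree, by
  \<open>pes_trace_conflict_free\<close> and \<open>en_not_enabling\<close>, so both impose the same
  condition.\<close>

text \<open>
  A removed pair never constrains a trace: two conflicting events cannot both occur in a trace,
  and two distinct causally related events are never enabled at the same time.
\<close>

lemma (in pes) pes_trace_conflict_free:
  assumes "pes_trace P \<sigma>" "e \<in> set \<sigma>" "e' \<in> set \<sigma>"
  shows "(e, e') \<notin> conflict P"
proof -
  \<comment> \<open>The later event is enabled by a prefix that already contains the earlier one.
    The case \<open>i < j\<close> below also needs symmetry, and \<open>i = j\<close> needs
    irreflexivity.\<close>
  have earlier: "(\<sigma> ! j, \<sigma> ! i) \<notin> conflict P" if "i < j" "j < length \<sigma>" for i j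
  proof -
    have "\<sigma> ! i \<in> set (take j \<sigma>)"
      using that by (auto simp: in_set_conv_nth)
    moreover have "\<sigma> ! j \<in> en P (take j \<sigma>)"
      using assms(1) that by (simp add: pes_trace_def)
    ultimately show ?thesis
      by (auto simp: en_def)
  qed
  obtain i j where "i < length \<sigma>" "e = \<sigma> ! i" "j < length \<sigma>" "e' = \<sigma> ! j"
    using assms(2,3) by (auto simp: in_set_conv_nth)
  then show ?thesis
    using earlier[of i j] earlier[of j i] conflict_irrefl conflict_sym
    by (cases i j rule: linorder_cases) (auto dest: symD irreflD)
qed

text \<open>A proper cause of \<open>e'\<close> must already lie in \<sigma>, whereas
  \<open>e\<close>, being enabled, lies outside it.\<close>

lemma en_not_enabling:
  assumes "e \<in> en P \<sigma>" "e' \<in> en P \<sigma>" "e \<noteq> e'"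
  shows "(e, e') \<notin> enabling P"
  using assms by (auto simp: en_def)

lemma en_priority_update [simp]: "en (P\<lparr>priority := R\<rparr>) = en P"
  by (simp add: en_def fun_eq_iff)

lemma pes_trace_priority_update [simp]: "pes_trace (P\<lparr>priority := R\<rparr>) = pes_trace P"
  by (simp add: pes_trace_def fun_eq_iff)

lemma (in ppes) Traces_priority_restrict:
  assumes R: "R = priority P -
      {(e, e'). (e', e) \<in> conflict P \<or> (e', e) \<in> enabling P \<or> (e, e') \<in> enabling P}"
  shows "Traces (P\<lparr>priority := R\<rparr>) = Traces P"
proof -
  have "(\<sigma> ! h, \<sigma> ! j) \<in> R \<longleftrightarrow> (\<sigma> ! h, \<sigma> ! j) \<in> priority P"
    if "pes_trace P \<sigma>" "j < length \<sigma>" "h < length \<sigma>" "\<sigma> ! j \<noteq> \<sigma> ! h"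
      "\<sigma> ! j \<in> en P (take i \<sigma>)" "\<sigma> ! h \<in> en P (take i \<sigma>)" for \<sigma> i j h
    using that pes_trace_conflict_free[of \<sigma> "\<sigma> ! j" "\<sigma> ! h"]
      en_not_enabling[of "\<sigma> ! j" P _ "\<sigma> ! h"] en_not_enabling[of "\<sigma> ! h" P _ "\<sigma> ! j"]
    by (auto simp: R)
  then show ?thesis
    \<comment> \<open>\<open>conj_cong\<close> supplies \<open>pes_trace P \<sigma>\<close> and the
      guards before the priority atom as premises for rewriting that atom.\<close>
    unfolding Traces_def ppes_trace_def by (simp cong: conj_cong)
qed

theorem theorem1:
  fixes E :: "'e set" and confl le prio prio' :: "('e \<times> 'e) set" and l :: "'e \<Rightarrow> 'a"
  assumes "ppes \<lparr>events = E, conflict = confl, enabling = le, label = l, priority = prio\<rparr>"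
    and "prio' = prio - {(e, e'). (e', e) \<in> confl \<or> (e', e) \<in> le \<or> (e, e') \<in> le}"
  shows "Traces \<lparr>events = E, conflict = confl, enabling = le, label = l, priority = prio\<rparr> =
         Traces \<lparr>events = E, conflict = confl, enabling = le, label = l, priority = prio'\<rparr>"
  using ppes.Traces_priority_restrict[OF assms(1), of prio'] assms(2) by simp

end
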